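(* For $r>0$ let $t=e^{-r}$, and let $(X_{n,t})_{n\ge1}$ be independent random variables with $P(X_{n,t}=n)=\frac{t^n}{1+t^n}$ and $P(X_{n,t}=0)=\frac{1}{1+t^n}$. Let $m(t)=\sum_{n\ge1}\frac{nt^n}{1+t^n}$, $\sigma^2(t)=\sum_{n\ge1}\frac{n^2t^n}{(1+t^n)^2}$, $X_t=\sum_{n\ge1}X_{n,t}$, $Z_t=\frac{X_t-m(t)}{\sigma(t)}$ and $\varphi_{Z_t}(\theta)=E(e^{i\theta Z_t})$. Then $$\lim_{t\to1}\int_{-\pi\sigma(t)}^{\pi\sigma(t)}\left|\varphi_{Z_t}(\theta)-e^{-\theta^2/2}\right|d\theta=0.$$
   Context: $\sigma(t)=\sqrt{\sigma^2(t)}$. The variable $X_t$ has law $\sum_{n\ge0}\frac{q(n)t^n}{f(t)}\delta_n$ where $f(z)=\prod_{n\ge1}(1+z^n)=\sum_n q(n)z^n$, $q(n)$ being the number of partitions of $n$ into distinct parts. *)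

theory Defs
  imports "HOL-Probability.Probability"
begin

text \<open>Series over \<open>n \<ge> 1\<close> are written as series over \<open>k \<ge> 0\<close> with \<open>n = Suc k\<close>.\<close>

definition mean_fn :: "real \<Rightarrow> real" where
  "mean_fn t = (\<Sum>k. real (Suc k) * t ^ Suc k / (1 + t ^ Suc k))"

definition var_fn :: "real \<Rightarrow> real" where
  "var_fn t = (\<Sum>k. (real (Suc k))\<^sup>2 * t ^ Suc k / (1 + t ^ Suc k)\<^sup>2)"

definition sd_fn :: "real \<Rightarrow> real" where
  "sd_fn t = sqrt (var_fn t)"

text \<open>
  In the following, \<open>X n t\<close> is the summand \<open>X\<^sub>n\<^sub>,\<^sub>t\<close>; only indices \<open>n \<ge> 1\<close> matter.
  In the setting of interest almost surely only finitely many summands are nonzero, so the real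
  series converges almost surely; its value on the exceptional null set is irrelevant.
\<close>

definition total :: "(nat \<Rightarrow> real \<Rightarrow> 'a \<Rightarrow> real) \<Rightarrow> real \<Rightarrow> 'a \<Rightarrow> real" where
  "total X t \<omega> = (\<Sum>k. X (Suc k) t \<omega>)"

definition normalized :: "(nat \<Rightarrow> real \<Rightarrow> 'a \<Rightarrow> real) \<Rightarrow> real \<Rightarrow> 'a \<Rightarrow> real" where
  "normalized X t \<omega> = (total X t \<omega> - mean_fn t) / sd_fn t"

end

theory Submission
  imports Defs
begin

text \<open>
  The characteristic function of \<open>Z\<^sub>t\<close> is the limit of finite products of characteristic
  functions of centred two-point laws, since by Borel--Cantelli only finitely many summands are
  nonzero. Write \<open>w\<^sub>n = t\<^sup>n / (1 + t\<^sup>n)\<^sup>2\<close> and \<open>u = \<theta> / \<sigma>(t)\<close>. Comparing each factor with the Gaussian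
  factor of the same variance \<open>n\<^sup>2 w\<^sub>n\<close> costs at most \<open>w\<^sub>n \<bar>n u\<bar>\<^sup>3 / 6 + w\<^sub>n\<^sup>2 (n u)\<^sup>4 / 8\<close>; as \<open>\<sigma>\<^sup>2(t)\<close> has
  the order of \<open>(1 - t)\<^sup>-\<^sup>3\<close>, these errors add up to \<open>O(\<bar>\<theta>\<bar>\<^sup>3 (1 - t)\<^sup>1\<^sup>/\<^sup>2 + \<theta>\<^sup>4 (1 - t))\<close>, which gives
  pointwise convergence.

  For domination on \<open>\<bar>\<theta>\<bar> \<le> \<pi> \<sigma>(t)\<close>, i.e. \<open>\<bar>u\<bar> \<le> \<pi>\<close>, each factor is at most \<open>exp (- w\<^sub>n (1 - cos (n u)))\<close>.
  With \<open>N\<close> of the order of \<open>1 / (1 - t)\<close> one has \<open>w\<^sub>n \<ge> 1 / 8\<close> for \<open>n \<le> N\<close>, and the sum of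
  \<open>1 - cos (n u)\<close> over \<open>n \<le> N\<close> is at least a constant times \<open>min (u\<^sup>2 N\<^sup>3) N\<close>: by the quadratic
  bound on the cosine if \<open>N \<bar>u\<bar> \<le> \<pi>\<close>, and by summing the Dirichlet kernel otherwise. Since
  \<open>\<sigma>\<^sup>2(t)\<close> is of the order of \<open>N\<^sup>3\<close>, in both cases the characteristic function is
  \<open>O(1 / (1 + \<theta>\<^sup>2))\<close>.
\<close>

section \<open>Power sums against a geometric sequence\<close>

lemma Suc_power_diff_le: "real (Suc n) ^ Suc m - real n ^ Suc m \<le> real (Suc m) * real (Suc n) ^ m"
proof (induction m)
  case (Suc m)
  have "real (Suc n) ^ Suc (Suc m) - real n ^ Suc (Suc m)
      = real (Suc n) * (real (Suc n) ^ Suc m - real n ^ Suc m) + real n ^ Suc m"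
    by (simp add: algebra_simps)
  also have "\<dots> \<le> real (Suc n) * (real (Suc m) * real (Suc n) ^ m) + real (Suc n) ^ Suc m"
    by (intro add_mono mult_left_mono Suc power_mono) auto
  also have "\<dots> = real (Suc (Suc m)) * real (Suc n) ^ Suc m"
    by (simp add: algebra_simps)
  finally show ?case .
qed simp

text \<open>Summation by parts: multiplying by \<open>1 - t\<close> replaces
  \<open>n ^ Suc m\<close> by its differences, which have degree \<open>m\<close>. The boundary term
  stays on the left so that the induction on \<open>L\<close> closes.\<close>

lemma power_geometric_partial_sum_step:
  fixes t :: real
  assumes "0 < t"
  shows "(1 - t) * (\<Sum>k<L. real (Suc k) ^ Suc m * t ^ Suc k) + real L ^ Suc m * t ^ Suc L
    \<le> real (Suc m) * (\<Sum>k<L. real (Suc k) ^ m * t ^ Suc k)"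
proof (induction L)
  case (Suc L)
  have "(real (Suc L) ^ Suc m - real L ^ Suc m) * t ^ Suc L \<le> (real (Suc m) * real (Suc L) ^ m) * t ^ Suc L"
    using assms by (intro mult_right_mono Suc_power_diff_le) auto
  with Suc show ?case by (simp add: algebra_simps)
qed simp

text \<open>Each increase of the exponent costs a factor \<open>Suc m / (1 - t)\<close>, starting
  from the geometric sum. The bound is uniform in \<open>L\<close>, so it also yields
  summability.\<close>

lemma power_geometric_partial_sum_le:
  fixes t :: real
  assumes "0 < t" "t < 1"
  shows "(\<Sum>k<L. real (Suc k) ^ m * t ^ Suc k) \<le> fact m / (1 - t) ^ Suc m"
proof (induction m)
  case 0
  have "(\<Sum>k<L. t ^ Suc k) = t * ((1 - t ^ L) / (1 - t))"
    using assms by (simp add: sum_distrib_left[symmetric] geometric_sum field_simps)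
  also have "\<dots> \<le> 1 * (1 / (1 - t))"
    using assms by (intro mult_mono divide_right_mono divide_nonneg_nonneg) (auto intro: power_le_one)
  finally show ?case by simp
next
  case (Suc m)
  have "0 \<le> real L ^ Suc m * t ^ Suc L" using assms by simp
  hence "(1 - t) * (\<Sum>k<L. real (Suc k) ^ Suc m * t ^ Suc k)
      \<le> real (Suc m) * (\<Sum>k<L. real (Suc k) ^ m * t ^ Suc k)"
    using power_geometric_partial_sum_step[OF assms(1), where L = L and m = m] by linarith
  also have "\<dots> \<le> real (Suc m) * (fact m / (1 - t) ^ Suc m)"
    by (intro mult_left_mono Suc) auto
  finally have "(\<Sum>k<L. real (Suc k) ^ Suc m * t ^ Suc k) \<le> real (Suc m) * (fact m / (1 - t) ^ Suc m) / (1 - t)"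
    using assms by (simp only: pos_le_divide_eq) (simp add: mult.commute)
  thus ?case by (simp add: field_simps)
qed

lemma summable_power_geometric:
  fixes t :: real
  assumes "0 < t" "t < 1"
  shows "summable (\<lambda>k. real (Suc k) ^ m * t ^ Suc k)"
  by (rule summableI_nonneg_bounded[OF _ power_geometric_partial_sum_le[OF assms]]) (use assms in auto)

section \<open>The centred two-point law\<close>

text \<open>The characteristic function at \<open>a\<close> of \<open>B - p\<close>, with
  \<open>B\<close> Bernoulli of parameter \<open>p\<close>.\<close>

definition bernoulli_char :: "real \<Rightarrow> real \<Rightarrow> complex" where
  "bernoulli_char p a = (1 - p) * iexp (- (p * a)) + p * iexp ((1 - p) * a)"

lemma bernoulli_char_eq: "bernoulli_char p a = iexp (- (p * a)) * (1 - p + p * iexp a)"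
  by (simp add: bernoulli_char_def algebra_simps exp_add[symmetric])

text \<open>The squared modulus is exactly \<open>1 - 2 * p * (1 - p) * (1 - cos a)\<close>; then
  \<open>1 + x \<le> exp x\<close>.\<close>

lemma cmod_bernoulli_char_le:
  assumes "0 \<le> p" "p \<le> 1"
  shows "cmod (bernoulli_char p a) \<le> exp (- (p * (1 - p) * (1 - cos a)))"
proof -
  have "(cmod (bernoulli_char p a))\<^sup>2 = (cmod (1 - p + p * iexp a))\<^sup>2"
    by (simp add: bernoulli_char_eq norm_mult)
  also have "\<dots> = (1 - p + p * cos a)\<^sup>2 + (p * sin a)\<^sup>2"
    by (simp add: cmod_power2 Re_exp Im_exp)
  also have "\<dots> = (1 - p)\<^sup>2 + 2 * p * (1 - p) * cos a + p\<^sup>2 * ((cos a)\<^sup>2 + (sin a)\<^sup>2)"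
    by (simp only: power2_eq_square) (simp only: algebra_simps)
  also have "\<dots> = (1 - p)\<^sup>2 + 2 * p * (1 - p) * cos a + p\<^sup>2"
    by simp
  also have "\<dots> = 1 + (- (2 * (p * (1 - p) * (1 - cos a))))"
    by (simp add: power2_eq_square algebra_simps)
  also have "\<dots> \<le> exp (- (2 * (p * (1 - p) * (1 - cos a))))"
    by (rule exp_ge_add_one_self)
  also have "\<dots> = (exp (- (p * (1 - p) * (1 - cos a))))\<^sup>2"
    by (simp add: exp_double[symmetric])
  finally show ?thesis
    by (rule power2_le_imp_le) simp
qed

lemma cmod_bernoulli_char_le_1:
  assumes "0 \<le> p" "p \<le> 1"
  shows "cmod (bernoulli_char p a) \<le> 1"
  using assms by (intro order.trans[OF cmod_bernoulli_char_le[OF assms]]) simp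

lemma iexp_approx_quadratic: "cmod (iexp x - (1 + \<i> * x - x\<^sup>2 / 2)) \<le> \<bar>x\<bar> ^ 3 / 6"
  using iexp_approx1[of x 2]
  by (simp add: numeral_eq_Suc atMost_Suc fact_reduce power_mult_distrib algebra_simps)

text \<open>Expand both exponentials to second order: centring cancels the linear terms, the
  quadratic ones add up to the variance, and the cubic remainders carry the extra factor
  \<open>p\<^sup>2 + (1 - p)\<^sup>2\<close>, at most 1.\<close>

lemma bernoulli_char_approx:
  assumes "0 \<le> p" "p \<le> 1"
  shows "cmod (bernoulli_char p a - (1 - p * (1 - p) * a\<^sup>2 / 2)) \<le> p * (1 - p) * \<bar>a\<bar> ^ 3 / 6"
proof -
  define E where "E x = iexp x - (1 + \<i> * x - x\<^sup>2 / 2)" for x :: real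
  have E: "cmod (E x) \<le> \<bar>x\<bar> ^ 3 / 6" for x
    unfolding E_def by (rule iexp_approx_quadratic)
  have "bernoulli_char p a - (1 - p * (1 - p) * a\<^sup>2 / 2)
      = (1 - p) * E (- (p * a)) + p * E ((1 - p) * a)"
    by (simp add: bernoulli_char_def E_def field_simps power2_eq_square)
  also have "cmod \<dots> \<le> cmod ((1 - p) * E (- (p * a))) + cmod (p * E ((1 - p) * a))"
    by (rule norm_triangle_ineq)
  also have "\<dots> = (1 - p) * cmod (E (- (p * a))) + p * cmod (E ((1 - p) * a))"
    using assms norm_of_real[of "1 - p", where 'a = complex] by (simp add: norm_mult)
  also have "\<dots> \<le> (1 - p) * (\<bar>- (p * a)\<bar> ^ 3 / 6) + p * (\<bar>(1 - p) * a\<bar> ^ 3 / 6)"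
    using assms by (intro add_mono mult_left_mono E) auto
  also have "\<dots> = p * (1 - p) * \<bar>a\<bar> ^ 3 / 6 * (p\<^sup>2 + (1 - p)\<^sup>2)"
  proof -
    have "\<bar>(1 - p) * a\<bar> = (1 - p) * \<bar>a\<bar>" "\<bar>- (p * a)\<bar> = p * \<bar>a\<bar>"
      using assms by (simp_all add: abs_mult)
    thus ?thesis by (simp only: power_mult_distrib) (simp add: power2_eq_square power3_eq_cube field_simps)
  qed
  also have "\<dots> \<le> p * (1 - p) * \<bar>a\<bar> ^ 3 / 6 * (p + (1 - p))"
    using assms by (intro mult_left_mono add_mono) (auto simp: power2_eq_square mult_left_le)
  finally show ?thesis by simp
qed

lemma exp_minus_approx:
  fixes x :: real
  assumes "0 \<le> x"
  shows "\<bar>exp (- x) - (1 - x)\<bar> \<le> x\<^sup>2 / 2"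
proof -
  have "exp (- x) \<le> 1 - x + x\<^sup>2 / 2"
  proof (cases "x = 0")
    case False
    then obtain s where "exp (- x) = (\<Sum>m<3. (- x) ^ m / fact m) + exp s / fact 3 * (- x) ^ 3"
      using Maclaurin_exp_le[of "- x" 3] by blast
    moreover have "exp s / fact 3 * (- x) ^ 3 \<le> 0"
      using assms by (simp add: mult_nonneg_nonpos power3_eq_cube)
    ultimately show ?thesis by (simp add: numeral_eq_Suc)
  qed simp
  moreover have "1 - x \<le> exp (- x)" using exp_ge_add_one_self[of "- x"] by simp
  ultimately show ?thesis by simp
qed

lemma bernoulli_char_gauss:
  assumes "0 \<le> p" "p \<le> 1"
  shows "cmod (bernoulli_char p a - exp (- (p * (1 - p) * a\<^sup>2 / 2)))
    \<le> p * (1 - p) * \<bar>a\<bar> ^ 3 / 6 + (p * (1 - p))\<^sup>2 * a ^ 4 / 8"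
proof -
  let ?x = "p * (1 - p) * a\<^sup>2 / 2"
  have "cmod (exp (- ?x) - (1 - ?x)) = \<bar>exp (- ?x) - (1 - ?x)\<bar>"
    by (metis norm_of_real real_norm_def)
  also have "\<dots> \<le> ?x\<^sup>2 / 2"
    using assms by (intro exp_minus_approx) auto
  finally have "cmod (exp (- ?x) - (1 - ?x)) \<le> (p * (1 - p))\<^sup>2 * a ^ 4 / 8"
    by (simp add: power_mult_distrib power_divide)
  moreover have "cmod (bernoulli_char p a - (1 - ?x)) \<le> p * (1 - p) * \<bar>a\<bar> ^ 3 / 6"
    using bernoulli_char_approx[OF assms, of a] by simp
  ultimately show ?thesis
    using norm_triangle_ineq4[of "bernoulli_char p a - (1 - ?x)" "exp (- ?x) - (1 - ?x)"]
    by simp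
qed

section \<open>Sums of cosines\<close>

lemma sin_ge_half:
  fixes y :: real
  assumes "0 \<le> y" "y \<le> pi / 2"
  shows "y / 2 \<le> sin y"
proof -
  have "\<bar>sin y - y\<bar> \<le> y ^ 3 / 6"
    using Maclaurin_sin_bound[of y 3] assms
    by (simp add: numeral_eq_Suc sin_coeff_def fact_reduce)
  \<comment> \<open>1.7 exceeds \<open>pi / 2\<close> and its square 2.89 is below 3, so the cubic
    error is at most \<open>y / 2\<close>.\<close>
  moreover have "y\<^sup>2 \<le> (17 / 10)\<^sup>2"
    using assms pi_approx by (intro power_mono) auto
  hence "y * y\<^sup>2 \<le> y * 3"
    using assms by (intro mult_left_mono) (auto simp: power2_eq_square)
  hence "y ^ 3 \<le> 3 * y"
    by (simp add: power3_eq_cube power2_eq_square)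
  ultimately show ?thesis by linarith
qed

lemma one_minus_cos_ge:
  fixes x :: real
  assumes "\<bar>x\<bar> \<le> pi"
  shows "x\<^sup>2 / 8 \<le> 1 - cos x"
proof -
  have "(\<bar>x\<bar> / 2 / 2)\<^sup>2 \<le> (sin (\<bar>x\<bar> / 2))\<^sup>2"
    using assms by (intro power_mono sin_ge_half) auto
  moreover have "cos \<bar>x\<bar> = 1 - 2 * (sin (\<bar>x\<bar> / 2))\<^sup>2"
    using cos_double_sin[of "\<bar>x\<bar> / 2"] by simp
  ultimately show ?thesis by (simp add: power_divide)
qed

text \<open>Multiplying by \<open>2 * sin (u / 2)\<close> makes the sum telescope.\<close>

lemma sum_cos_dirichlet:
  fixes u :: real
  shows "2 * sin (u / 2) * (\<Sum>k<N. cos (real (Suc k) * u)) = sin (real N * u + u / 2) - sin (u / 2)"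
proof (induction N)
  case (Suc N)
  have "2 * sin (u / 2) * cos (real (Suc N) * u) = sin (real (Suc N) * u + u / 2) - sin (real (Suc N) * u - u / 2)"
    by (simp add: sin_add sin_diff)
  moreover have "real (Suc N) * u - u / 2 = real N * u + u / 2"
    by (simp add: field_simps)
  ultimately show ?case using Suc by (simp add: distrib_left add.commute)
qed simp

lemma sum_cos_le:
  fixes u :: real
  assumes "0 < u" "u \<le> pi"
  shows "(\<Sum>k<N. cos (real (Suc k) * u)) \<le> 2 / u"
proof -
  let ?S = "\<Sum>k<N. cos (real (Suc k) * u)"
  have s: "u / 4 \<le> sin (u / 2)" using sin_ge_half[of "u / 2"] assms by simp
  show ?thesis
  proof (cases "?S \<le> 0")
    case False
    have "u / 2 * ?S \<le> 2 * sin (u / 2) * ?S"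
      using s False by (intro mult_right_mono) auto
    also have "\<dots> \<le> 1"
      unfolding sum_cos_dirichlet using s assms sin_le_one[of "real N * u + u / 2"] by linarith
    finally show ?thesis using assms by (simp add: field_simps)
  qed (use assms in \<open>auto intro: order.trans[of _ 0]\<close>)
qed

lemma sum_squares_ge: "real N ^ 3 / 3 \<le> (\<Sum>k<N. (real (Suc k))\<^sup>2)"
  by (induction N) (auto simp: power2_eq_square power3_eq_cube field_simps)

text \<open>In the quadratic regime 24 is 8 from \<open>one_minus_cos_ge\<close> times 3 from
  \<open>sum_squares_ge\<close>. Otherwise \<open>N * \<bar>u\<bar> > pi > 3\<close>, so the cosines
  sum to at most \<open>2 * N / 3\<close>, leaving \<open>N / 3\<close>.\<close>

lemma sum_one_minus_cos_ge:
  fixes u :: real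
  assumes "\<bar>u\<bar> \<le> pi"
  shows "min (u\<^sup>2 * real N ^ 3 / 24) (real N / 3) \<le> (\<Sum>k<N. 1 - cos (real (Suc k) * u))"
proof (cases "real N * \<bar>u\<bar> \<le> pi")
  case True
  have "u\<^sup>2 * real N ^ 3 / 24 \<le> u\<^sup>2 / 8 * (\<Sum>k<N. (real (Suc k))\<^sup>2)"
    using mult_left_mono[OF sum_squares_ge, of "u\<^sup>2 / 8" N] by simp
  also have "\<dots> = (\<Sum>k<N. (real (Suc k) * u)\<^sup>2 / 8)"
    by (simp add: sum_distrib_left power_mult_distrib mult.commute)
  also have "\<dots> \<le> (\<Sum>k<N. 1 - cos (real (Suc k) * u))"
  proof (intro sum_mono one_minus_cos_ge)
    fix k assume "k \<in> {..<N}"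
    hence "real (Suc k) * \<bar>u\<bar> \<le> real N * \<bar>u\<bar>" by (intro mult_right_mono) auto
    thus "\<bar>real (Suc k) * u\<bar> \<le> pi" using True by (simp add: abs_mult)
  qed
  finally show ?thesis by linarith
next
  case False
  hence u: "\<bar>u\<bar> > 0" and "N > 0" by (auto intro: gr0I)
  have "(\<Sum>k<N. cos (real (Suc k) * u)) = (\<Sum>k<N. cos (real (Suc k) * \<bar>u\<bar>))"
    by (intro sum.cong refl) (metis abs_mult abs_of_nat cos_abs_real)
  also have "\<dots> \<le> 2 / \<bar>u\<bar>" by (rule sum_cos_le[OF u assms])
  also have "\<dots> \<le> 2 * real N / 3"
  proof -
    have "3 \<le> real N * \<bar>u\<bar>" using False pi_gt3 by linarith
    thus ?thesis using u by (simp add: field_simps)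
  qed
  finally show ?thesis by (simp add: sum_subtractf)
qed


section \<open>The summands\<close>

text \<open>For \<open>n \<ge> 1\<close>, the probability that the summand with index
  \<open>n\<close> takes the value \<open>n\<close>.\<close>

definition prob_fn :: "real \<Rightarrow> nat \<Rightarrow> real" where
  "prob_fn t n = t ^ n / (1 + t ^ n)"

lemma prob_fn_bounds:
  assumes "0 < t"
  shows "0 \<le> prob_fn t n" "prob_fn t n \<le> 1" "prob_fn t n \<le> t ^ n"
  using assms by (auto simp: prob_fn_def field_simps add_pos_pos)

lemma one_minus_prob_fn:
  assumes "0 < t"
  shows "1 - prob_fn t n = 1 / (1 + t ^ n)"
proof -
  have "1 + t ^ n \<noteq> 0" using assms by (metis add_pos_pos less_irrefl zero_less_one zero_less_power)
  thus ?thesis by (simp add: prob_fn_def field_simps)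
qed

lemma prob_fn_var:
  assumes "0 < t"
  shows "prob_fn t n * (1 - prob_fn t n) = t ^ n / (1 + t ^ n)\<^sup>2"
  unfolding one_minus_prob_fn[OF assms] by (simp add: prob_fn_def power2_eq_square)

lemma prob_fn_var_le:
  assumes "0 < t"
  shows "0 \<le> prob_fn t n * (1 - prob_fn t n)" "prob_fn t n * (1 - prob_fn t n) \<le> t ^ n"
    "(prob_fn t n * (1 - prob_fn t n))\<^sup>2 \<le> t ^ n"
proof -
  note b = prob_fn_bounds[OF assms, of n]
  show 1: "0 \<le> prob_fn t n * (1 - prob_fn t n)" using b by auto
  have 2: "prob_fn t n * (1 - prob_fn t n) \<le> prob_fn t n"
    using b by (simp add: mult_left_le)
  thus 3: "prob_fn t n * (1 - prob_fn t n) \<le> t ^ n" using b by linarith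
  have "prob_fn t n * (1 - prob_fn t n) \<le> 1" using 2 b by linarith
  from mult_left_le[OF this 1] 3
  show "(prob_fn t n * (1 - prob_fn t n))\<^sup>2 \<le> t ^ n" by (simp add: power2_eq_square)
qed

text \<open>The weights used are the probabilities (\<open>m\<close> = 0, 1), the variances
  (\<open>m\<close> = 2, 3) and the squared variances (\<open>m\<close> = 4), all dominated by
  \<open>t ^ n\<close>.\<close>

lemma summable_weighted:
  fixes t :: real
  assumes "0 < t" "t < 1" "\<And>n. 0 \<le> w n" "\<And>n. w n \<le> t ^ n"
  shows "summable (\<lambda>k. real (Suc k) ^ m * w (Suc k))"
    and "(\<Sum>k<L. real (Suc k) ^ m * w (Suc k)) \<le> fact m / (1 - t) ^ Suc m"
proof -
  have le: "real (Suc k) ^ m * w (Suc k) \<le> real (Suc k) ^ m * t ^ Suc k" for k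
    by (intro mult_left_mono assms) auto
  show "summable (\<lambda>k. real (Suc k) ^ m * w (Suc k))"
    by (rule summable_comparison_test'[OF summable_power_geometric[OF assms(1,2), of m], of 0])
      (use le assms(3) in \<open>auto simp: abs_mult\<close>)
  show "(\<Sum>k<L. real (Suc k) ^ m * w (Suc k)) \<le> fact m / (1 - t) ^ Suc m"
    by (rule order.trans[OF sum_mono[OF le] power_geometric_partial_sum_le[OF assms(1,2)]])
qed

lemma mean_fn_sums:
  assumes "0 < t" "t < 1"
  shows "(\<lambda>k. real (Suc k) * prob_fn t (Suc k)) sums mean_fn t"
proof -
  have "summable (\<lambda>k. real (Suc k) ^ 1 * prob_fn t (Suc k))"
    by (rule summable_weighted[OF assms]) (use prob_fn_bounds assms in auto)
  thus ?thesis
    by (simp add: mean_fn_def prob_fn_def sums_iff)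
qed

lemma var_fn_sums:
  assumes "0 < t" "t < 1"
  shows "(\<lambda>k. (real (Suc k))\<^sup>2 * (prob_fn t (Suc k) * (1 - prob_fn t (Suc k)))) sums var_fn t"
proof -
  have "summable (\<lambda>k. real (Suc k) ^ 2 * (prob_fn t (Suc k) * (1 - prob_fn t (Suc k))))"
    by (rule summable_weighted[OF assms]) (use prob_fn_var_le assms in auto)
  thus ?thesis unfolding prob_fn_var[OF assms(1)]
    by (simp add: var_fn_def sums_iff)
qed

lemma var_fn_le:
  assumes "0 < t" "t < 1"
  shows "var_fn t \<le> 2 / (1 - t) ^ 3"
  unfolding sums_unique[OF var_fn_sums[OF assms]]
proof (rule suminf_le_const[OF sums_summable[OF var_fn_sums[OF assms]]])
  fix L
  have "(\<Sum>k<L. (real (Suc k))\<^sup>2 * (prob_fn t (Suc k) * (1 - prob_fn t (Suc k)))) \<le> fact 2 / (1 - t) ^ Suc 2"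
    by (rule summable_weighted[OF assms]) (use prob_fn_var_le assms in auto)
  thus "(\<Sum>k<L. (real (Suc k))\<^sup>2 * (prob_fn t (Suc k) * (1 - prob_fn t (Suc k)))) \<le> 2 / (1 - t) ^ 3"
    by (simp add: numeral_eq_Suc)
qed

text \<open>Up to \<open>cutoff t\<close>, Bernoulli's inequality keeps \<open>t ^ n\<close> above \<open>1 / 2\<close>.\<close>

definition cutoff :: "real \<Rightarrow> nat" where
  "cutoff t = nat \<lfloor>1 / (2 * (1 - t))\<rfloor>"

lemma cutoff_bounds:
  assumes "1 / 2 \<le> t" "t < 1"
  shows "1 \<le> cutoff t" "2 * (1 - t) * real (cutoff t) \<le> 1" "1 \<le> 4 * (1 - t) * real (cutoff t)"
    "1 \<le> 64 * (1 - t) ^ 3 * real (cutoff t) ^ 3"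
proof -
  define a where "a = 1 / (2 * (1 - t))"
  have a: "1 \<le> a" "2 * (1 - t) * a = 1" using assms by (auto simp: a_def field_simps)
  have c: "cutoff t = nat \<lfloor>a\<rfloor>" "real (cutoff t) = of_int \<lfloor>a\<rfloor>"
  proof -
    show "cutoff t = nat \<lfloor>a\<rfloor>" unfolding cutoff_def a_def ..
    thus "real (cutoff t) = of_int \<lfloor>a\<rfloor>" using a(1) by simp
  qed
  show 1: "1 \<le> cutoff t" using a(1) c by (simp add: nat_le_iff le_nat_iff le_floor_iff)
  have "2 * (1 - t) * real (cutoff t) \<le> 2 * (1 - t) * a"
    using assms c by (intro mult_left_mono) auto
  thus "2 * (1 - t) * real (cutoff t) \<le> 1" using a by simp
  \<comment> \<open>The floor of \<open>a\<close> is at least 1 and \<open>a\<close> exceeds it by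
    less than 1, so rounding loses at most a factor 2.\<close>
  have "a \<le> 2 * real (cutoff t)" using c(2) 1 by linarith
  hence "2 * (1 - t) * a \<le> 2 * (1 - t) * (2 * real (cutoff t))"
    using assms by (intro mult_left_mono) auto
  thus 2: "1 \<le> 4 * (1 - t) * real (cutoff t)" using a(2) by linarith
  have "1 ^ 3 \<le> (4 * (1 - t) * real (cutoff t)) ^ 3"
    by (intro power_mono 2) auto
  thus "1 \<le> 64 * (1 - t) ^ 3 * real (cutoff t) ^ 3"
    by (simp only: power_mult_distrib) simp
qed

text \<open>With \<open>t ^ n\<close> between 1/2 and 1, the numerator in \<open>prob_fn_var\<close>
  is at least 1/2 and the denominator at most 4.\<close>

lemma prob_fn_var_ge:
  assumes "1 / 2 \<le> t" "t < 1" "n \<le> cutoff t"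
  shows "1 / 8 \<le> prob_fn t n * (1 - prob_fn t n)"
proof -
  have "2 * (1 - t) * real n \<le> 2 * (1 - t) * real (cutoff t)"
    using assms by (intro mult_left_mono) auto
  hence "1 / 2 \<le> 1 + real n * (t - 1)"
    using cutoff_bounds(2)[OF assms(1,2)] by (simp add: algebra_simps)
  also have "\<dots> \<le> t ^ n"
    using Bernoulli_inequality[of "t - 1" n] assms by simp
  finally have lo: "1 / 2 \<le> t ^ n" .
  have hi: "t ^ n \<le> 1" using assms by (intro power_le_one) auto
  have "(1 + t ^ n)\<^sup>2 \<le> 2\<^sup>2" using lo hi by (intro power_mono) auto
  hence "(1 / 2) / 4 \<le> t ^ n / (1 + t ^ n)\<^sup>2"
    using lo by (intro frac_le) auto
  thus ?thesis using prob_fn_var[of t n] assms by simp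
qed

lemma var_fn_ge:
  assumes "1 / 2 \<le> t" "t < 1"
  shows "1 / (1536 * (1 - t) ^ 3) \<le> var_fn t"
proof -
  let ?N = "cutoff t"
  have t: "0 < t" using assms by simp
  \<comment> \<open>1536 = 8 * 3 * 64, with 64 from the cubed cutoff bound.\<close>
  have "1 / (1536 * (1 - t) ^ 3) \<le> 1 / 8 * (real ?N ^ 3 / 3)"
    using cutoff_bounds(4)[OF assms] assms by (simp add: field_simps)
  also have "\<dots> \<le> 1 / 8 * (\<Sum>k<?N. (real (Suc k))\<^sup>2)"
    by (intro mult_left_mono sum_squares_ge) auto
  also have "\<dots> = (\<Sum>k<?N. (real (Suc k))\<^sup>2 * (1 / 8))"
    by (simp add: sum_distrib_left mult.commute)
  also have "\<dots> \<le> (\<Sum>k<?N. (real (Suc k))\<^sup>2 * (prob_fn t (Suc k) * (1 - prob_fn t (Suc k))))"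
    by (intro sum_mono mult_left_mono prob_fn_var_ge assms) auto
  also have "\<dots> \<le> var_fn t"
    unfolding sums_unique[OF var_fn_sums[OF t assms(2)]]
    by (intro sum_le_suminf sums_summable[OF var_fn_sums[OF t assms(2)]])
      (auto intro: mult_nonneg_nonneg[OF _ prob_fn_var_le(1)[OF t]])
  finally show ?thesis .
qed

lemma sd_fn_pos:
  assumes "1 / 2 \<le> t" "t < 1"
  shows "0 < sd_fn t"
proof -
  have "0 < 1 / (1536 * (1 - t) ^ 3)" using assms by simp
  with var_fn_ge[OF assms] have "0 < var_fn t" by linarith
  thus ?thesis by (simp add: sd_fn_def)
qed

lemma sd_fn_squared:
  assumes "0 < t" "t < 1"
  shows "(sd_fn t)\<^sup>2 = var_fn t"
  using sums_le[OF _ sums_zero var_fn_sums[OF assms]] prob_fn_var_le(1)[OF assms(1)]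
  by (simp add: sd_fn_def)

section \<open>Partial products of the characteristic function\<close>

text \<open>The characteristic function of the first \<open>L\<close> centred independent summands,
  divided by the standard deviation of the full sum.\<close>

definition partial_char :: "real \<Rightarrow> real \<Rightarrow> nat \<Rightarrow> complex" where
  "partial_char t \<theta> L = (\<Prod>k<L. bernoulli_char (prob_fn t (Suc k)) (real (Suc k) * (\<theta> / sd_fn t)))"

lemma cmod_partial_char_le:
  assumes "1 / 2 \<le> t" "t < 1" "\<bar>\<theta>\<bar> \<le> pi * sd_fn t" "cutoff t \<le> L"
  shows "cmod (partial_char t \<theta> L) \<le> 1000000000 / (1 + \<theta>\<^sup>2)"
proof -
  let ?N = "real (cutoff t)" and ?b = "\<lambda>k. bernoulli_char (prob_fn t (Suc k)) (real (Suc k) * (\<theta> / sd_fn t))"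
  define u where "u = \<theta> / sd_fn t"
  have t: "0 < t" using assms by simp
  note sd = sd_fn_pos[OF assms(1,2)]
  have u: "\<bar>u\<bar> \<le> pi" using assms(3) sd by (simp add: u_def field_simps)
  have N: "1 \<le> ?N" using cutoff_bounds(1)[OF assms(1,2)] by simp
  have "2 / (1 - t) ^ 3 \<le> 128 * ?N ^ 3"
    using cutoff_bounds(4)[OF assms(1,2)] assms by (simp add: field_simps)
  hence var: "(sd_fn t)\<^sup>2 \<le> 128 * ?N ^ 3"
    using var_fn_le[OF t assms(2)] sd_fn_squared[OF t assms(2)] by simp
  have th: "\<theta>\<^sup>2 = u\<^sup>2 * (sd_fn t)\<^sup>2" using sd by (simp add: u_def power_divide)
  let ?S = "\<Sum>k<cutoff t. 1 - cos (real (Suc k) * u)"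
  have "cmod (partial_char t \<theta> L) = (\<Prod>k<L. cmod (?b k))"
    by (simp add: partial_char_def prod_norm)
  \<comment> \<open>Factors beyond the cutoff have modulus at most 1 and are discarded.\<close>
  also have "\<dots> \<le> (\<Prod>k<cutoff t. cmod (?b k))"
  proof -
    have "(\<Prod>k<L. cmod (?b k)) = (\<Prod>k\<in>{..<L} - {..<cutoff t}. cmod (?b k)) * (\<Prod>k<cutoff t. cmod (?b k))"
      using assms(4) by (intro prod.subset_diff) auto
    also have "\<dots> \<le> 1 * (\<Prod>k<cutoff t. cmod (?b k))"
      using t by (intro mult_right_mono prod_le_1 prod_nonneg)
        (auto intro!: cmod_bernoulli_char_le_1 prob_fn_bounds)
    finally show ?thesis by simp
  qed
  also have "\<dots> \<le> (\<Prod>k<cutoff t. exp (- (1 / 8 * (1 - cos (real (Suc k) * u)))))"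
  proof (intro prod_mono conjI norm_ge_zero)
    fix k assume "k \<in> {..<cutoff t}"
    hence "1 / 8 * (1 - cos (real (Suc k) * u))
        \<le> prob_fn t (Suc k) * (1 - prob_fn t (Suc k)) * (1 - cos (real (Suc k) * u))"
      by (intro mult_right_mono prob_fn_var_ge assms) auto
    moreover have "cmod (?b k) \<le> exp (- (prob_fn t (Suc k) * (1 - prob_fn t (Suc k)) * (1 - cos (real (Suc k) * u))))"
      unfolding u_def by (intro cmod_bernoulli_char_le prob_fn_bounds t)
    ultimately show "cmod (?b k) \<le> exp (- (1 / 8 * (1 - cos (real (Suc k) * u))))"
      by (elim order.trans) simp
  qed
  also have "\<dots> = exp (- (?S / 8))"
    by (simp add: exp_sum[symmetric] sum_negf sum_divide_distrib[symmetric])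
  finally have bound: "cmod (partial_char t \<theta> L) \<le> exp (- (?S / 8))" .
  show ?thesis
  proof (cases "u\<^sup>2 * ?N ^ 3 / 24 \<le> ?N / 3")
    case True
    \<comment> \<open>24576 = 128 * 24 * 8, with 128 from the upper bound on the variance.\<close>
    have "\<theta>\<^sup>2 / 24576 \<le> u\<^sup>2 * ?N ^ 3 / 24 / 8"
      unfolding th using mult_left_mono[OF var, of "u\<^sup>2"] by simp
    also have "\<dots> \<le> ?S / 8"
      using sum_one_minus_cos_ge[OF u, of "cutoff t"] True by (intro divide_right_mono) auto
    finally have "1 + \<theta>\<^sup>2 / 24576 \<le> exp (?S / 8)"
      using exp_ge_add_one_self[of "?S / 8"] by linarith
    hence "exp (- (?S / 8)) \<le> 1 / (1 + \<theta>\<^sup>2 / 24576)"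
      by (simp add: exp_minus inverse_eq_divide frac_le add_pos_nonneg)
    also have "\<dots> \<le> 1000000000 / (1 + \<theta>\<^sup>2)"
      by (simp add: divide_simps add_nonneg_eq_0_iff add_pos_nonneg)
    finally show ?thesis using bound by linarith
  next
    case False
    have "?N / 24 \<le> ?S / 8"
      using sum_one_minus_cos_ge[OF u, of "cutoff t"] False by simp
    \<comment> \<open>Here \<theta> squared can be as large as order \<open>N ^ 3\<close>, so the
      exponential decay in \<open>N\<close> is traded for a cubic one.\<close>
    have "(?N / 72) ^ 3 \<le> exp (?N / 72) ^ 3"
      using exp_ge_add_one_self[of "?N / 72"] by (intro power_mono) linarith+
    also have "\<dots> = exp (?N / 24)"
      by (simp flip: exp_of_nat_mult)
    also have "\<dots> \<le> exp (?S / 8)" using \<open>?N / 24 \<le> ?S / 8\<close> by simp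
    finally have small: "exp (- (?S / 8)) \<le> 1 / ((?N / 72) ^ 3)"
      using N by (simp add: exp_minus inverse_eq_divide frac_le)
    have "1 + \<theta>\<^sup>2 \<le> 2049 * ?N ^ 3"
    proof -
      have "u\<^sup>2 \<le> 4\<^sup>2" using u pi_less_4 by (subst abs_le_square_iff[symmetric]) auto
      hence "\<theta>\<^sup>2 \<le> 4\<^sup>2 * (128 * ?N ^ 3)" unfolding th using var by (intro mult_mono) auto
      moreover have "1 \<le> ?N ^ 3" using N by (rule one_le_power)
      ultimately show ?thesis by simp
    qed
    \<comment> \<open>This fixes the size of the constant in the lemma: 2049 * 72 ^ 3 is about 7.6 *
      10 ^ 8.\<close>
    moreover have "2049 * c \<le> 1000000000 * (c / 72 ^ 3)" if "0 \<le> c" for c :: real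
      using that by simp
    ultimately have "1 + \<theta>\<^sup>2 \<le> 1000000000 * (?N / 72) ^ 3"
      unfolding power_divide by (meson order.trans of_nat_0_le_iff zero_le_power)
    hence "1 / ((?N / 72) ^ 3) \<le> 1000000000 / (1 + \<theta>\<^sup>2)"
      using N by (simp add: divide_simps add_nonneg_eq_0_iff add_pos_nonneg)
    thus ?thesis using bound small by linarith
  qed
qed

lemma partial_char_gauss:
  assumes "1 / 2 \<le> t" "t < 1"
  shows "cmod (partial_char t \<theta> L - (\<Prod>k<L. exp (- (prob_fn t (Suc k) * (1 - prob_fn t (Suc k)) * (real (Suc k) * (\<theta> / sd_fn t))\<^sup>2 / 2))))
    \<le> 64000 * \<bar>\<theta>\<bar> ^ 3 * sqrt (1 - t) + 7680000 * \<theta> ^ 4 * (1 - t)"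
proof -
  define u where "u = \<theta> / sd_fn t"
  define v where "v n = prob_fn t n * (1 - prob_fn t n)" for n
  have t: "0 < t" using assms by simp
  note sd = sd_fn_pos[OF assms]
  \<comment> \<open>The standard deviation has order \<open>(1 - t)\<close> to the power -3/2; in
    terms of \<open>s\<close> all exponents are integers.\<close>
  define s where "s = sqrt (1 - t)"
  have power4_abs: "\<bar>u\<bar> ^ 4 = u ^ 4" by simp
  have s: "0 < s" "s\<^sup>2 = 1 - t" using assms by (auto simp: s_def)
  have "1 / (40 * s ^ 3) \<le> sd_fn t"
  proof (rule power2_le_imp_le)
    have "(1 / (40 * s ^ 3))\<^sup>2 = 1 / (1600 * (s\<^sup>2) ^ 3)" by (simp add: power_divide power_mult_distrib flip: power_mult)
    \<comment> \<open>1536 is rounded up to the square of 40.\<close>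
    also have "\<dots> \<le> 1 / (1536 * (1 - t) ^ 3)" unfolding s using assms by (intro frac_le) auto
    also have "\<dots> \<le> (sd_fn t)\<^sup>2" using var_fn_ge[OF assms] sd_fn_squared[OF t assms(2)] by simp
    finally show "(1 / (40 * s ^ 3))\<^sup>2 \<le> (sd_fn t)\<^sup>2" .
  qed (use sd in simp)
  hence "\<bar>u\<bar> \<le> 40 * s ^ 3 * \<bar>\<theta>\<bar>"
    using sd s mult_left_mono[of "1 / (40 * s ^ 3)" "sd_fn t" "40 * s ^ 3 * \<bar>\<theta>\<bar>"] by (simp add: u_def field_simps)
  hence u: "\<bar>u\<bar> ^ m \<le> (40 * s ^ 3 * \<bar>\<theta>\<bar>) ^ m" for m by (intro power_mono) auto
  \<comment> \<open>All factors have modulus at most 1, so replacing them one at a time bounds the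
    difference of the products by the sum of the differences.\<close>
  have "cmod (partial_char t \<theta> L - (\<Prod>k<L. complex_of_real (exp (- (v (Suc k) * (real (Suc k) * u)\<^sup>2 / 2)))))
    \<le> (\<Sum>k<L. cmod (bernoulli_char (prob_fn t (Suc k)) (real (Suc k) * u) - complex_of_real (exp (- (v (Suc k) * (real (Suc k) * u)\<^sup>2 / 2)))))"
    unfolding partial_char_def u_def[symmetric]
    by (intro norm_prod_diff) (auto intro!: cmod_bernoulli_char_le_1 prob_fn_bounds t mult_nonneg_nonneg[OF prob_fn_var_le(1)] simp: v_def)
  also have "\<dots> \<le> (\<Sum>k<L. v (Suc k) * \<bar>real (Suc k) * u\<bar> ^ 3 / 6 + (v (Suc k))\<^sup>2 * (real (Suc k) * u) ^ 4 / 8)"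
    unfolding v_def by (intro sum_mono bernoulli_char_gauss prob_fn_bounds t)
  also have "\<dots> = \<bar>u\<bar> ^ 3 / 6 * (\<Sum>k<L. real (Suc k) ^ 3 * v (Suc k)) + \<bar>u\<bar> ^ 4 / 8 * (\<Sum>k<L. real (Suc k) ^ 4 * (v (Suc k))\<^sup>2)"
    by (simp only: sum.distrib sum_distrib_left abs_mult power_mult_distrib abs_of_nat power4_abs)
      (simp add: mult_ac)
  also have "\<dots> \<le> (40 * s ^ 3 * \<bar>\<theta>\<bar>) ^ 3 / 6 * (fact 3 / (1 - t) ^ Suc 3) + (40 * s ^ 3 * \<bar>\<theta>\<bar>) ^ 4 / 8 * (fact 4 / (1 - t) ^ Suc 4)"
    by (intro add_mono mult_mono divide_right_mono u summable_weighted(2)[OF t assms(2)])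
      (auto intro!: sum_nonneg mult_nonneg_nonneg prob_fn_var_le t simp: v_def less_imp_le[OF s(1)] simp del: power_mult_distrib)
  also have "\<dots> = 64000 * \<bar>\<theta>\<bar> ^ 3 * (s ^ 9 / (s\<^sup>2) ^ 4) + 7680000 * \<theta> ^ 4 * (s ^ 12 / (s\<^sup>2) ^ 5)"
    unfolding s by (simp add: power_mult_distrib fact_numeral flip: power_mult)
  also have "\<dots> = 64000 * \<bar>\<theta>\<bar> ^ 3 * s + 7680000 * \<theta> ^ 4 * s\<^sup>2"
    using s(1) by (simp add: field_simps power_numeral_reduce flip: power_mult)
  finally show ?thesis unfolding s(2) by (simp add: s_def v_def u_def)
qed

text \<open>The exponents add up to \<theta> squared over 2 times the share of the variance in the
  first \<open>L\<close> terms, which tends to 1.\<close>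

lemma gauss_product_tendsto:
  assumes "1 / 2 \<le> t" "t < 1"
  shows "(\<lambda>L. \<Prod>k<L. exp (- (prob_fn t (Suc k) * (1 - prob_fn t (Suc k)) * (real (Suc k) * (\<theta> / sd_fn t))\<^sup>2 / 2)))
    \<longlonglongrightarrow> exp (- (\<theta>\<^sup>2 / 2))"
proof -
  let ?v = "\<lambda>k. (real (Suc k))\<^sup>2 * (prob_fn t (Suc k) * (1 - prob_fn t (Suc k)))"
  have t: "0 < t" using assms by simp
  have "(\<lambda>L. exp (- ((\<theta> / sd_fn t)\<^sup>2 / 2 * (\<Sum>k<L. ?v k)))) \<longlonglongrightarrow> exp (- ((\<theta> / sd_fn t)\<^sup>2 / 2 * var_fn t))"
    using var_fn_sums[OF t assms(2)] unfolding sums_def by (intro tendsto_intros)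
  also have "(\<theta> / sd_fn t)\<^sup>2 / 2 * var_fn t = \<theta>\<^sup>2 / 2"
    using sd_fn_pos[OF assms] by (simp add: power_divide flip: sd_fn_squared[OF t assms(2)])
  finally show ?thesis
    by (simp only: exp_sum[OF finite_lessThan, symmetric] sum_negf sum_distrib_left)
      (simp add: power_mult_distrib power_divide mult_ac)
qed


section \<open>The characteristic function of the normalised sum\<close>

context prob_space
begin

text \<open>The two atoms have total mass 1, so the integrand is almost everywhere a combination of
  two indicators.\<close>

lemma char_two_point:
  assumes X: "random_variable borel X" and "a \<noteq> b"
    and "prob {\<omega> \<in> space M. X \<omega> = a} = p" "prob {\<omega> \<in> space M. X \<omega> = b} = 1 - p"
  shows "char (distr M borel X) u
    = complex_of_real p * iexp (u * a) + complex_of_real (1 - p) * iexp (u * b)"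
proof -
  let ?A = "{\<omega> \<in> space M. X \<omega> = a}" and ?B = "{\<omega> \<in> space M. X \<omega> = b}"
  have [measurable]: "X \<in> borel_measurable M" "?A \<in> sets M" "?B \<in> sets M"
    using X by measurable
  have "prob (?A \<union> ?B) = 1"
    using assms by (subst finite_measure_Union) auto
  hence AE: "AE \<omega> in M. \<omega> \<in> ?A \<union> ?B"
    by (subst (asm) prob_eq_1) auto
  have "char (distr M borel X) u = (LINT \<omega>|M. iexp (u * X \<omega>))"
    by (simp add: char_def integral_distr)
  also have "\<dots> = (LINT \<omega>|M. indicator ?A \<omega> *\<^sub>R iexp (u * a) + indicator ?B \<omega> *\<^sub>R iexp (u * b))"
  proof (intro integral_cong_AE)
    show "AE \<omega> in M. iexp (u * X \<omega>) = indicator ?A \<omega> *\<^sub>R iexp (u * a) + indicator ?B \<omega> *\<^sub>R iexp (u * b)"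
      using AE by (rule eventually_mono) (use \<open>a \<noteq> b\<close> in \<open>auto simp: indicator_def\<close>)
  qed auto
  also have "\<dots> = complex_of_real p * iexp (u * a) + complex_of_real (1 - p) * iexp (u * b)"
    using assms by (simp add: scaleR_conv_of_real emeasure_eq_measure)
  finally show ?thesis by simp
qed

lemma char_normalized:
  assumes t: "0 < t" "t < 1"
    and indep: "indep_vars (\<lambda>_. borel) (\<lambda>n. X n t) {1..}"
    and n: "\<And>n. n \<ge> 1 \<Longrightarrow> prob {\<omega> \<in> space M. X n t \<omega> = real n} = prob_fn t n"
    and 0: "\<And>n. n \<ge> 1 \<Longrightarrow> prob {\<omega> \<in> space M. X n t \<omega> = 0} = 1 - prob_fn t n"
  shows "random_variable borel (normalized X t)"
    and "partial_char t \<theta> \<longlonglongrightarrow> char (distr M borel (normalized X t)) \<theta>"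
proof -
  define Y where "Y k = X (Suc k) t" for k
  define u where "u = \<theta> / sd_fn t"
  have [measurable]: "Y k \<in> borel_measurable M" for k
    using indep by (auto simp: indep_vars_def Y_def)
  have norm_eq: "normalized X t = (\<lambda>\<omega>. ((\<Sum>k. Y k \<omega>) - mean_fn t) / sd_fn t)"
    by (auto simp: normalized_def total_def Y_def)
  show meas [measurable]: "normalized X t \<in> borel_measurable M"
    unfolding norm_eq by measurable

  have nz: "prob {\<omega> \<in> space M. Y k \<omega> \<noteq> 0} = prob_fn t (Suc k)" for k
  proof -
    have "prob (space M - {\<omega> \<in> space M. Y k \<omega> = 0}) = prob_fn t (Suc k)"
      using 0[of "Suc k"] by (subst prob_compl) (measurable, simp add: Y_def)
    also have "space M - {\<omega> \<in> space M. Y k \<omega> = 0} = {\<omega> \<in> space M. Y k \<omega> \<noteq> 0}" by auto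
    finally show ?thesis .
  qed
  \<comment> \<open>The zeroth moment is the sum of the probabilities of nonzero summands, as
    Borel-Cantelli requires.\<close>
  have "summable (\<lambda>k. real (Suc k) ^ 0 * prob_fn t (Suc k))"
    by (rule summable_weighted[OF t]) (use prob_fn_bounds t in auto)
  hence "AE \<omega> in M. eventually (\<lambda>k. \<omega> \<in> space M - {\<omega> \<in> space M. Y k \<omega> \<noteq> 0}) sequentially"
    by (intro borel_cantelli_AE1) (auto simp: nz emeasure_eq_measure)
  hence lim: "AE \<omega> in M. (\<lambda>L. \<Sum>k<L. Y k \<omega>) \<longlonglongrightarrow> (\<Sum>k. Y k \<omega>)"
  proof eventually_elim
    case (elim \<omega>)
    hence "eventually (\<lambda>k. Y k \<omega> = 0) sequentially" by eventually_elim auto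
    hence "summable (\<lambda>k. Y k \<omega>)"
      by (subst summable_cong[where g = "\<lambda>_. 0"]) auto
    thus ?case by (rule summable_LIMSEQ)
  qed

  have part: "partial_char t \<theta> L = (LINT \<omega>|M. iexp (u * ((\<Sum>k<L. Y k \<omega>) - (\<Sum>k<L. real (Suc k) * prob_fn t (Suc k)))))" for L
  proof -
    have "partial_char t \<theta> L = (\<Prod>k<L. char (distr M borel (Y k)) u * iexp (- (u * (real (Suc k) * prob_fn t (Suc k)))))"
      unfolding partial_char_def
    proof (intro prod.cong refl)
      fix k
      let ?p = "prob_fn t (Suc k)"
      have "char (distr M borel (Y k)) u = complex_of_real ?p * iexp (u * real (Suc k)) + complex_of_real (1 - ?p) * iexp (u * 0)"
        using n[of "Suc k"] 0[of "Suc k"] by (intro char_two_point) (auto simp: Y_def[symmetric])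
      thus "bernoulli_char ?p (real (Suc k) * (\<theta> / sd_fn t)) = char (distr M borel (Y k)) u * iexp (- (u * (real (Suc k) * ?p)))"
        unfolding u_def[symmetric] bernoulli_char_eq by (simp add: mult_ac add_ac)
    qed
    also have "\<dots> = char (distr M borel (\<lambda>\<omega>. \<Sum>k<L. Y k \<omega>)) u * iexp (- (u * (\<Sum>k<L. real (Suc k) * prob_fn t (Suc k))))"
    proof -
      have "char (distr M borel (\<lambda>\<omega>. \<Sum>k<L. Y k \<omega>)) u = (\<Prod>k<L. char (distr M borel (Y k)) u)"
        using char_distr_sum[OF indep_vars_subset[OF indep, of "{Suc 0..L}"], of u]
        by (simp add: sum.atLeast1_atMost_eq prod.atLeast1_atMost_eq Y_def)
      thus ?thesis
        by (simp add: prod.distrib sum_distrib_left exp_sum[symmetric] sum_negf)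
    qed
    also have "\<dots> = (LINT \<omega>|M. iexp (u * (\<Sum>k<L. Y k \<omega>)) * iexp (- (u * (\<Sum>k<L. real (Suc k) * prob_fn t (Suc k)))))"
      by (simp add: char_def integral_distr)
    finally show ?thesis by (simp add: algebra_simps flip: exp_add)
  qed
  have "char (distr M borel (normalized X t)) \<theta> = (LINT \<omega>|M. iexp (u * ((\<Sum>k. Y k \<omega>) - mean_fn t)))"
    by (simp add: char_def integral_distr norm_eq u_def)
  \<comment> \<open>The integrands are unimodular, hence dominated by 1 on a probability
    space.\<close>
  moreover have "partial_char t \<theta> \<longlonglongrightarrow> (LINT \<omega>|M. iexp (u * ((\<Sum>k. Y k \<omega>) - mean_fn t)))"
    unfolding part
  proof (rule integral_dominated_convergence[where w = "\<lambda>_. 1"])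
    show "AE \<omega> in M. (\<lambda>L. iexp (u * ((\<Sum>k<L. Y k \<omega>) - (\<Sum>k<L. real (Suc k) * prob_fn t (Suc k)))))
        \<longlonglongrightarrow> iexp (u * ((\<Sum>k. Y k \<omega>) - mean_fn t))"
      using lim
    proof eventually_elim
      case (elim \<omega>)
      show ?case by (intro elim mean_fn_sums[OF t, unfolded sums_def] tendsto_intros)
    qed
  qed auto
  ultimately show "partial_char t \<theta> \<longlonglongrightarrow> char (distr M borel (normalized X t)) \<theta>" by simp
qed

end

section \<open>Dominated convergence of the integrals\<close>

lemma integrable_inverse_one_plus_square: "integrable lborel (\<lambda>x::real. c / (1 + x\<^sup>2))"
  using integrable_mult_right[of c, OF integrable_inverse_1_plus_square[unfolded set_integrable_def]]
  by (simp add: divide_inverse)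

theorem theorem4p4:
  fixes M :: "real \<Rightarrow> 'a measure"
    and X :: "nat \<Rightarrow> real \<Rightarrow> 'a \<Rightarrow> real"
  assumes "\<And>r t. r > 0 \<Longrightarrow> t = exp (- r) \<Longrightarrow> prob_space (M t)"
    and "\<And>r t. r > 0 \<Longrightarrow> t = exp (- r) \<Longrightarrow>
           prob_space.indep_vars (M t) (\<lambda>_. borel) (\<lambda>n. X n t) {1..}"
    and "\<And>r t n. r > 0 \<Longrightarrow> t = exp (- r) \<Longrightarrow> n \<ge> 1 \<Longrightarrow>
           measure (M t) {\<omega> \<in> space (M t). X n t \<omega> = real n} = t ^ n / (1 + t ^ n)"
    and "\<And>r t n. r > 0 \<Longrightarrow> t = exp (- r) \<Longrightarrow> n \<ge> 1 \<Longrightarrow>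
           measure (M t) {\<omega> \<in> space (M t). X n t \<omega> = 0} = 1 / (1 + t ^ n)"
  shows "((\<lambda>t. LBINT \<theta>:{- (pi * sd_fn t)..pi * sd_fn t}.
             cmod (char (distr (M t) borel (normalized X t)) \<theta>
                   - complex_of_real (exp (- (\<theta>\<^sup>2 / 2)))))
          \<longlongrightarrow> 0) (at_left 1)"
proof -
  define \<phi> where "\<phi> t = char (distr (M t) borel (normalized X t))" for t
  define G where "G \<theta> = complex_of_real (exp (- (\<theta>\<^sup>2 / 2)))" for \<theta> :: real
  have facts: "\<phi> t \<in> borel_measurable borel" "partial_char t \<theta> \<longlonglongrightarrow> \<phi> t \<theta>"
    if "1 / 2 \<le> t" "t < 1" for t \<theta>
  proof -
    \<comment> \<open>\<open>r = - ln t\<close> makes the hypotheses on \<open>exp (- r)\<close>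
      apply to \<open>t\<close>.\<close>
    have t: "0 < t" "0 < - ln t" "t = exp (- (- ln t))" using that by auto
    interpret prob_space "M t" by (rule assms(1)[OF t(2,3)])
    have n: "prob {\<omega> \<in> space (M t). X n t \<omega> = real n} = prob_fn t n"
      and 0: "prob {\<omega> \<in> space (M t). X n t \<omega> = 0} = 1 - prob_fn t n" if "n \<ge> 1" for n
      using assms(3,4)[OF t(2,3) that] by (simp_all add: prob_fn_def one_minus_prob_fn[OF t(1), unfolded prob_fn_def])
    note ch = char_normalized[where X = X and t = t, OF t(1) that(2) assms(2)[OF t(2,3)] n 0]
    interpret D: real_distribution "distr (M t) borel (normalized X t)"
      by (rule real_distribution_distr[OF ch(1)])
    show "\<phi> t \<in> borel_measurable borel" unfolding \<phi>_def by (rule D.char_measurable)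
    show "partial_char t \<theta> \<longlonglongrightarrow> \<phi> t \<theta>" unfolding \<phi>_def by (rule ch(2))
  qed
  have G: "cmod (G \<theta>) \<le> 2 / (1 + \<theta>\<^sup>2)" for \<theta>
  proof -
    have "1 + \<theta>\<^sup>2 / 2 \<le> exp (\<theta>\<^sup>2 / 2)" by (rule exp_ge_add_one_self)
    hence "exp (- (\<theta>\<^sup>2 / 2)) \<le> 1 / (1 + \<theta>\<^sup>2 / 2)"
      by (simp add: exp_minus inverse_eq_divide frac_le add_pos_nonneg)
    also have "\<dots> \<le> 2 / (1 + \<theta>\<^sup>2)" by (simp add: divide_simps add_nonneg_eq_0_iff add_pos_nonneg)
    finally show ?thesis by (simp add: G_def)
  qed
  have bound: "cmod (\<phi> t \<theta>) \<le> 1000000000 / (1 + \<theta>\<^sup>2)"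
    if "1 / 2 \<le> t" "t < 1" "\<bar>\<theta>\<bar> \<le> pi * sd_fn t" for t \<theta>
    \<comment> \<open>The partial products obey the bound once \<open>L\<close> reaches the cutoff,
      and it survives the limit.\<close>
    by (rule tendsto_upperbound[OF tendsto_norm[OF facts(2)[OF that(1,2)]]])
      (use cmod_partial_char_le[OF that] in \<open>auto simp: eventually_sequentially\<close>)
  have near: "cmod (\<phi> t \<theta> - G \<theta>) \<le> 64000 * \<bar>\<theta>\<bar> ^ 3 * sqrt (1 - t) + 7680000 * \<theta> ^ 4 * (1 - t)"
    if "1 / 2 \<le> t" "t < 1" for t \<theta>
    unfolding G_def
    by (rule tendsto_upperbound[OF tendsto_norm[OF tendsto_diff[OF facts(2)[OF that]
        tendsto_of_real[OF gauss_product_tendsto[OF that]]]]])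
      (use partial_char_gauss[OF that] in auto)
  \<comment> \<open>The indicator moves the varying interval into the integrand, so all integrals
    run over the whole line.\<close>
  define F where "F t \<theta> = indicator {- (pi * sd_fn t)..pi * sd_fn t} \<theta> *\<^sub>R cmod (\<phi> t \<theta> - G \<theta>)" for t \<theta>
  have "((\<lambda>t. LINT \<theta>|lborel. F t \<theta>) \<longlongrightarrow> 0) (at_left 1)"
    unfolding tendsto_at_iff_sequentially comp_def
  proof safe
    fix T :: "nat \<Rightarrow> real"
    assume T: "\<forall>i. T i \<in> {..<1} - {1}" "T \<longlonglongrightarrow> 1"
    have "eventually (\<lambda>i. 1 / 2 < T i) sequentially"
      by (rule order_tendstoD(1)[OF T(2)]) simp
    then obtain i0 where "\<forall>i\<ge>i0. 1 / 2 < T i"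
      unfolding eventually_sequentially ..
    hence i0: "1 / 2 \<le> T (i + i0)" for i by (simp add: less_imp_le)
    \<comment> \<open>Shifting the sequence keeps every term in \<open>[1/2, 1)\<close>, where the
      estimates hold; \<open>LIMSEQ_offset\<close> undoes the shift.\<close>
    define S where "S i = T (i + i0)" for i
    have S: "1 / 2 \<le> S i" "S i < 1" for i using i0 T(1) by (auto simp: S_def)
    have S_lim: "S \<longlonglongrightarrow> 1" unfolding S_def by (rule LIMSEQ_ignore_initial_segment[OF T(2)])
    have "(\<lambda>i. LINT \<theta>|lborel. F (S i) \<theta>) \<longlonglongrightarrow> (LINT \<theta>::real|lborel. (0::real))"
    proof (rule integral_dominated_convergence[where w = "\<lambda>\<theta>. 1000000002 / (1 + \<theta>\<^sup>2)"])
      show "F (S i) \<in> borel_measurable lborel" for i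
      proof -
        note [measurable] = facts(1)[OF S]
        have "F (S i) \<in> borel_measurable borel" unfolding F_def G_def by measurable
        thus ?thesis by simp
      qed
      show "AE \<theta> in lborel. (\<lambda>i. F (S i) \<theta>) \<longlonglongrightarrow> 0"
      proof (intro AE_I2)
        fix \<theta> :: real
        have "(\<lambda>i. 64000 * \<bar>\<theta>\<bar> ^ 3 * sqrt (1 - S i) + 7680000 * \<theta> ^ 4 * (1 - S i))
            \<longlonglongrightarrow> 64000 * \<bar>\<theta>\<bar> ^ 3 * sqrt (1 - 1) + 7680000 * \<theta> ^ 4 * (1 - 1)"
          by (intro tendsto_intros S_lim)
        hence lim: "(\<lambda>i. 64000 * \<bar>\<theta>\<bar> ^ 3 * sqrt (1 - S i) + 7680000 * \<theta> ^ 4 * (1 - S i)) \<longlonglongrightarrow> 0"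
          by simp
        show "(\<lambda>i. F (S i) \<theta>) \<longlonglongrightarrow> 0"
        proof (rule Lim_null_comparison[OF always_eventually lim], intro allI)
          fix i
          have "norm (F (S i) \<theta>) \<le> cmod (\<phi> (S i) \<theta> - G \<theta>)"
            by (simp add: F_def indicator_def)
          also note near[OF S]
          finally show "norm (F (S i) \<theta>) \<le> 64000 * \<bar>\<theta>\<bar> ^ 3 * sqrt (1 - S i) + 7680000 * \<theta> ^ 4 * (1 - S i)" .
        qed
      qed
      show "AE \<theta> in lborel. norm (F (S i) \<theta>) \<le> 1000000002 / (1 + \<theta>\<^sup>2)" for i
      proof (intro AE_I2)
        fix \<theta> :: real
        show "norm (F (S i) \<theta>) \<le> 1000000002 / (1 + \<theta>\<^sup>2)"
        proof (cases "\<bar>\<theta>\<bar> \<le> pi * sd_fn (S i)")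
          case True
          have "norm (F (S i) \<theta>) \<le> cmod (\<phi> (S i) \<theta> - G \<theta>)"
            by (simp add: F_def indicator_def)
          also have "\<dots> \<le> cmod (\<phi> (S i) \<theta>) + cmod (G \<theta>)" by (rule norm_triangle_ineq4)
          also have "\<dots> \<le> 1000000000 / (1 + \<theta>\<^sup>2) + 2 / (1 + \<theta>\<^sup>2)"
            by (intro add_mono bound S True G)
          also have "\<dots> = 1000000002 / (1 + \<theta>\<^sup>2)" by (simp flip: add_divide_distrib)
          finally show ?thesis .
        qed (auto simp: F_def indicator_def)
      qed
    qed (auto intro: integrable_inverse_one_plus_square)
    hence "(\<lambda>i. LINT \<theta>|lborel. F (T (i + i0)) \<theta>) \<longlonglongrightarrow> 0" by (simp add: S_def)
    thus "(\<lambda>i. LINT \<theta>|lborel. F (T i) \<theta>) \<longlonglongrightarrow> 0" by (rule LIMSEQ_offset)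
  qed
  thus ?thesis by (simp add: F_def G_def \<phi>_def set_lebesgue_integral_def)
qed

end
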